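(* Let $G$ be a locally compact Hausdorff topological groupoid. There exists a map $\phi: S_G\times C(G)\to C(G)$ with the following properties. (1) $\phi(f_1\ast f_2,g)=\phi\big(f_1,\phi(f_2,g)\big)$ for all $g\in C(G)$ and $f_1,f_2\in S_G$. (2) $\phi(r,g)=g$ for all $g\in C(G)$, where $r(x)=xx^{-1}$. (3) For each $f\in S_G$ the map $L_f=\phi(f,\cdot):C(G)\to C(G)$ is a linear operator, and the map $f\mapsto L_f$ from $S_G$ to $\mathcal{L}(C(G))$ is an injective homomorphism. (4) If $f\in T_G$, then $L_f$ is an injective linear operator. (5) The group $H(1)$, the group of units of $S_G$, is embedded in the group of all invertible linear operators on $C(G)$.
   Context: A groupoid $G$ has a partially defined product $(x,y)\mapsto xy$ on the set $G^2\subset G\times G$ of composable pairs, and an inverse map $x\mapsto x^{-1}$. Put $r(x)=xx^{-1}$ and $d(x)=x^{-1}x$; a pair $(x,y)$ is composable if and only if $d(x)=r(y)$. The unit space is $G^0=r(G)=d(G)$, and for $u\in G^0$, $G_u=d^{-1}(u)$. A topological groupoid is a groupoid with a topology for which the inverse map and the product map $G^2\to G$ ($G^2$ with the topology induced from $G\times G$) are continuous; topologies are assumed locally compact and Hausdorff. $C(G,G)$ is the set of continuous maps from $G$ to $G$. Define $$S_G=\{f\in C(G,G): f(x)\in G_{r(x)}\text{ for all }x\in G\},$$ a monoid with operation $(f\ast g)(x)=g(f(x)x)f(x)$ and identity $r$. Let $$T_G=\{f\in S_G: \{f(x)x: x\in G\}\text{ is dense in }G\}.$$ $H(1)$ denotes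 the group of units (maximal subgroup containing the identity $r$) of $S_G$. $C(G)$ is the complex vector space of all continuous complex-valued functions on $G$, and $\mathcal{L}(C(G))$ is the monoid of all linear operators on $C(G)$ under composition of operators. "Embedded" means that there is an injective group homomorphism. *)

theory Defs
  imports "HOL-Analysis.Analysis" "HOL-Algebra.Group"
begin

section \<open>Topological groupoids\<close>

record 'a groupoid = "'a partial_object" +
  comps :: "('a \<times> 'a) set"
  gprod :: "'a \<Rightarrow> 'a \<Rightarrow> 'a"  (infixl \<open>\<cdot>\<index>\<close> 70)
  ginv :: "'a \<Rightarrow> 'a"

record 'a top_groupoid = "'a groupoid" +
  gtop :: "'a topology"

definition grange :: "('a, 'b) groupoid_scheme \<Rightarrow> 'a \<Rightarrow> 'a"
  where "grange G x = x \<cdot>\<^bsub>G\<^esub> ginv G x"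

definition gdomain :: "('a, 'b) groupoid_scheme \<Rightarrow> 'a \<Rightarrow> 'a"
  where "gdomain G x = ginv G x \<cdot>\<^bsub>G\<^esub> x"

definition gfibre :: "('a, 'b) groupoid_scheme \<Rightarrow> 'a \<Rightarrow> 'a set"
  where "gfibre G u = {x \<in> carrier G. gdomain G x = u}"

text \<open>These are the standard axioms (as in Renault's lecture notes) for a set with a partially
  defined product and an inverse map. The values of the product outside \<^term>\<open>comps G\<close> are
  unspecified. That \<open>(x, y)\<close> is composable iff \<open>d(x) = r(y)\<close> is derived below.\<close>

locale groupoid =
  fixes G :: "('a, 'b) groupoid_scheme" (structure)
  assumes comps_subset: "comps G \<subseteq> carrier G \<times> carrier G"
    and prod_closed: "(x, y) \<in> comps G \<Longrightarrow> x \<cdot> y \<in> carrier G"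
    and inv_closed: "x \<in> carrier G \<Longrightarrow> ginv G x \<in> carrier G"
    and inv_inv: "x \<in> carrier G \<Longrightarrow> ginv G (ginv G x) = x"
    and assoc_comps: "\<lbrakk>(x, y) \<in> comps G; (y, z) \<in> comps G\<rbrakk>
      \<Longrightarrow> (x \<cdot> y, z) \<in> comps G \<and> (x, y \<cdot> z) \<in> comps G"
    and assoc: "\<lbrakk>(x, y) \<in> comps G; (y, z) \<in> comps G\<rbrakk> \<Longrightarrow> (x \<cdot> y) \<cdot> z = x \<cdot> (y \<cdot> z)"
    and inv_left_comps: "x \<in> carrier G \<Longrightarrow> (ginv G x, x) \<in> comps G"
    and inv_left: "(x, y) \<in> comps G \<Longrightarrow> ginv G x \<cdot> (x \<cdot> y) = y"
    and inv_right_comps: "x \<in> carrier G \<Longrightarrow> (x, ginv G x) \<in> comps G"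
    and inv_right: "(z, x) \<in> comps G \<Longrightarrow> (z \<cdot> x) \<cdot> ginv G x = z"

locale top_groupoid = groupoid G for G :: "('a, 'b) top_groupoid_scheme" (structure) +
  assumes topspace_eq: "topspace (gtop G) = carrier G"
    and continuous_inv: "continuous_map (gtop G) (gtop G) (ginv G)"
    and continuous_prod: "continuous_map
      (subtopology (prod_topology (gtop G) (gtop G)) (comps G)) (gtop G) (\<lambda>(x, y). x \<cdot> y)"

locale lch_groupoid = top_groupoid G for G :: "('a, 'b) top_groupoid_scheme" (structure) +
  assumes locally_compact: "locally_compact_space (gtop G)"
    and Hausdorff: "Hausdorff_space (gtop G)"


section \<open>The monoid \<open>S\<^sub>G\<close> and its subset \<open>T\<^sub>G\<close>\<close>

text \<open>Maps on \<open>G\<close> are represented by extensional HOL functions, which are \<^term>\<open>undefined\<close> off the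
  carrier, so that equality of maps is equality of HOL functions.\<close>

definition S_monoid :: "('a, 'b) top_groupoid_scheme \<Rightarrow> ('a \<Rightarrow> 'a) monoid"
  where "S_monoid G =
    \<lparr>carrier = {f \<in> extensional (carrier G). continuous_map (gtop G) (gtop G) f \<and>
                  (\<forall>x\<in>carrier G. f x \<in> gfibre G (grange G x))},
     mult = (\<lambda>f g. \<lambda>x\<in>carrier G. g (f x \<cdot>\<^bsub>G\<^esub> x) \<cdot>\<^bsub>G\<^esub> f x),
     one = (\<lambda>x\<in>carrier G. grange G x)\<rparr>"

definition T_set :: "('a, 'b) top_groupoid_scheme \<Rightarrow> ('a \<Rightarrow> 'a) set"
  where "T_set G = {f \<in> carrier (S_monoid G).
    gtop G closure_of {f x \<cdot>\<^bsub>G\<^esub> x | x. x \<in> carrier G} = topspace (gtop G)}"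


section \<open>Linear operators on \<open>C(G)\<close>\<close>

definition C_space :: "('a, 'b) top_groupoid_scheme \<Rightarrow> ('a \<Rightarrow> complex) set"
  where "C_space G = {g \<in> extensional (carrier G). continuous_map (gtop G) euclidean g}"

definition C_add :: "('a, 'b) top_groupoid_scheme \<Rightarrow> ('a \<Rightarrow> complex) \<Rightarrow> ('a \<Rightarrow> complex) \<Rightarrow> 'a \<Rightarrow> complex"
  where "C_add G g h = (\<lambda>x\<in>carrier G. g x + h x)"

definition C_scale :: "('a, 'b) top_groupoid_scheme \<Rightarrow> complex \<Rightarrow> ('a \<Rightarrow> complex) \<Rightarrow> 'a \<Rightarrow> complex"
  where "C_scale G c g = (\<lambda>x\<in>carrier G. c * g x)"

definition linear_operators ::
    "('a, 'b) top_groupoid_scheme \<Rightarrow> (('a \<Rightarrow> complex) \<Rightarrow> ('a \<Rightarrow> complex)) set"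
  where "linear_operators G = {L \<in> C_space G \<rightarrow>\<^sub>E C_space G.
    (\<forall>g\<in>C_space G. \<forall>h\<in>C_space G. L (C_add G g h) = C_add G (L g) (L h)) \<and>
    (\<forall>c. \<forall>g\<in>C_space G. L (C_scale G c g) = C_scale G c (L g))}"

definition operator_monoid ::
    "('a, 'b) top_groupoid_scheme \<Rightarrow> (('a \<Rightarrow> complex) \<Rightarrow> ('a \<Rightarrow> complex)) monoid"
  where "operator_monoid G =
    \<lparr>carrier = linear_operators G,
     mult = (\<lambda>L M. compose (C_space G) L M),
     one = (\<lambda>g\<in>C_space G. g)\<rparr>"


section \<open>Well-definedness\<close>

context groupoid
begin

lemma compsD: "(x, y) \<in> comps G \<Longrightarrow> x \<in> carrier G" "(x, y) \<in> comps G \<Longrightarrow> y \<in> carrier G"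
  using comps_subset by auto

lemma grange_closed: "x \<in> carrier G \<Longrightarrow> grange G x \<in> carrier G"
  by (simp add: grange_def prod_closed inv_right_comps)

lemma grange_prod: "grange G x \<cdot> x = x" if "x \<in> carrier G"
  using that inv_left[of "ginv G x" x] inv_left[OF inv_left_comps]
  by (metis assoc grange_def inv_closed inv_inv inv_left_comps)

lemma prod_gdomain: "x \<cdot> gdomain G x = x" if "x \<in> carrier G"
  using that by (metis assoc gdomain_def inv_left_comps inv_right inv_right_comps inv_inv)

theorem composable_iff:
  assumes "x \<in> carrier G" "y \<in> carrier G"
  shows "(x, y) \<in> comps G \<longleftrightarrow> gdomain G x = grange G y"
proof
  assume xy: "(x, y) \<in> comps G"
  have "(ginv G x \<cdot> x) \<cdot> y = y"
    using assoc[OF inv_left_comps xy] inv_left[OF xy] assms by simp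
  moreover have "(ginv G x \<cdot> x, y) \<in> comps G"
    using assoc_comps[OF inv_left_comps xy] assms by simp
  ultimately show "gdomain G x = grange G y"
    using inv_right unfolding gdomain_def grange_def by metis
next
  assume eq: "gdomain G x = grange G y"
  have "(x, gdomain G x) \<in> comps G"
    using assoc_comps[OF inv_right_comps inv_left_comps] assms by (simp add: gdomain_def)
  moreover have "(grange G y, y) \<in> comps G"
    using assoc_comps[OF inv_right_comps inv_left_comps] assms by (simp add: grange_def)
  ultimately have "(x \<cdot> gdomain G x, y) \<in> comps G"
    using assoc_comps eq by metis
  then show "(x, y) \<in> comps G"
    using prod_gdomain assms by simp
qed

lemma grange_mult: "grange G (x \<cdot> y) = grange G x" if "(x, y) \<in> comps G"
proof -
  have "(ginv G x, x) \<in> comps G" "x \<in> carrier G" "y \<in> carrier G"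
    using that compsD inv_left_comps by auto
  then have "(ginv G x, x \<cdot> y) \<in> comps G" using assoc_comps that by blast
  then have "gdomain G (ginv G x) = grange G (x \<cdot> y)"
    using composable_iff compsD by metis
  then show ?thesis
    using \<open>x \<in> carrier G\<close> by (simp add: gdomain_def grange_def inv_inv)
qed

lemma gdomain_mult: "gdomain G (x \<cdot> y) = gdomain G y" if "(x, y) \<in> comps G"
proof -
  have "(y, ginv G y) \<in> comps G" "y \<in> carrier G"
    using that compsD inv_right_comps by auto
  then have "(x \<cdot> y, ginv G y) \<in> comps G" using assoc_comps that by blast
  then have "gdomain G (x \<cdot> y) = grange G (ginv G y)"
    using composable_iff compsD by metis
  then show ?thesis
    using \<open>y \<in> carrier G\<close> by (simp add: gdomain_def grange_def inv_inv)
qed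

lemma grange_grange: "grange G (grange G x) = grange G x" if "x \<in> carrier G"
  using that grange_mult[OF inv_right_comps] by (simp add: grange_def)

lemma gdomain_grange: "gdomain G (grange G x) = grange G x" if "x \<in> carrier G"
  using that gdomain_mult[OF inv_right_comps, of x]
  by (simp add: grange_def gdomain_def inv_inv)

end

context top_groupoid
begin

lemma continuous_gprod:
  assumes "continuous_map X (gtop G) a" "continuous_map X (gtop G) b"
    and "\<And>x. x \<in> topspace X \<Longrightarrow> (a x, b x) \<in> comps G"
  shows "continuous_map X (gtop G) (\<lambda>x. a x \<cdot> b x)"
proof -
  have "continuous_map X (subtopology (prod_topology (gtop G) (gtop G)) (comps G)) (\<lambda>x. (a x, b x))"
    using assms by (auto intro!: continuous_map_into_subtopology continuous_map_pairedI)
  from continuous_map_compose[OF this continuous_prod] show ?thesis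
    by (simp add: comp_def)
qed

lemma S_carrierD:
  assumes "f \<in> carrier (S_monoid G)"
  shows "continuous_map (gtop G) (gtop G) f" "f \<in> extensional (carrier G)"
    and "x \<in> carrier G \<Longrightarrow> f x \<in> carrier G"
    and "x \<in> carrier G \<Longrightarrow> gdomain G (f x) = grange G x"
    and "x \<in> carrier G \<Longrightarrow> (f x, x) \<in> comps G"
    and "x \<in> carrier G \<Longrightarrow> f x \<cdot> x \<in> carrier G"
  using assms composable_iff prod_closed by (auto simp: S_monoid_def gfibre_def)

lemma S_carrierI:
  assumes "continuous_map (gtop G) (gtop G) f"
    and "\<And>x. x \<in> carrier G \<Longrightarrow> f x \<in> carrier G \<and> gdomain G (f x) = grange G x"
  shows "restrict f (carrier G) \<in> carrier (S_monoid G)"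
  using assms continuous_map_eq[OF assms(1), of "restrict f (carrier G)"]
  by (auto simp: S_monoid_def gfibre_def topspace_eq)

lemma S_comp_comps:
  assumes "f \<in> carrier (S_monoid G)" "g \<in> carrier (S_monoid G)" "x \<in> carrier G"
  shows "(g (f x \<cdot> x), f x) \<in> comps G"
  using assms by (simp add: composable_iff S_carrierD grange_mult)

theorem S_monoid: "monoid (S_monoid G)"
proof (rule monoidI)
  fix f g assume f: "f \<in> carrier (S_monoid G)" and g: "g \<in> carrier (S_monoid G)"
  have "continuous_map (gtop G) (gtop G) (\<lambda>x. f x \<cdot> x)"
    using f by (intro continuous_gprod) (auto simp: topspace_eq S_carrierD)
  from continuous_map_compose[OF this S_carrierD(1)[OF g]]
  have "continuous_map (gtop G) (gtop G) (\<lambda>x. g (f x \<cdot> x) \<cdot> f x)"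
    using f g by (intro continuous_gprod) (auto simp: topspace_eq S_carrierD comp_def S_comp_comps)
  moreover have "g (f x \<cdot> x) \<cdot> f x \<in> carrier G \<and> gdomain G (g (f x \<cdot> x) \<cdot> f x) = grange G x"
    if "x \<in> carrier G" for x
    using S_comp_comps[OF f g that] f that by (auto simp: prod_closed gdomain_mult S_carrierD)
  ultimately have "(\<lambda>x\<in>carrier G. g (f x \<cdot> x) \<cdot> f x) \<in> carrier (S_monoid G)"
    by (intro S_carrierI) auto
  then show "f \<otimes>\<^bsub>S_monoid G\<^esub> g \<in> carrier (S_monoid G)"
    by (simp add: S_monoid_def)
next
  have "continuous_map (gtop G) (gtop G) (\<lambda>x. grange G x)"
    unfolding grange_def using continuous_inv
    by (intro continuous_gprod) (auto simp: topspace_eq inv_right_comps)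
  from S_carrierI[OF this] have "(\<lambda>x\<in>carrier G. grange G x) \<in> carrier (S_monoid G)"
    by (simp add: grange_closed gdomain_grange)
  then show "\<one>\<^bsub>S_monoid G\<^esub> \<in> carrier (S_monoid G)"
    by (simp add: S_monoid_def)
next
  fix f g h
  assume f: "f \<in> carrier (S_monoid G)" and g: "g \<in> carrier (S_monoid G)"
    and h: "h \<in> carrier (S_monoid G)"
  have "h (g (f x \<cdot> x) \<cdot> f x \<cdot> x) \<cdot> (g (f x \<cdot> x) \<cdot> f x) =
    h (g (f x \<cdot> x) \<cdot> (f x \<cdot> x)) \<cdot> g (f x \<cdot> x) \<cdot> f x" if x: "x \<in> carrier G" for x
    using assoc[OF S_comp_comps[OF f g x] S_carrierD(5)[OF f x]]
      assoc[OF S_comp_comps[OF g h S_carrierD(6)[OF f x]] S_comp_comps[OF f g x]] by simp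
  then show "f \<otimes>\<^bsub>S_monoid G\<^esub> g \<otimes>\<^bsub>S_monoid G\<^esub> h = f \<otimes>\<^bsub>S_monoid G\<^esub> (g \<otimes>\<^bsub>S_monoid G\<^esub> h)"
    using S_carrierD[OF f] by (auto simp: S_monoid_def fun_eq_iff restrict_def)
next
  fix f assume f: "f \<in> carrier (S_monoid G)"
  show "\<one>\<^bsub>S_monoid G\<^esub> \<otimes>\<^bsub>S_monoid G\<^esub> f = f"
  proof (rule extensionalityI)
    fix x assume x: "x \<in> carrier G"
    then show "(\<one>\<^bsub>S_monoid G\<^esub> \<otimes>\<^bsub>S_monoid G\<^esub> f) x = f x"
      using prod_gdomain[OF S_carrierD(3)[OF f x]] S_carrierD(4)[OF f x]
      by (simp add: S_monoid_def grange_prod)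
  qed (use S_carrierD(2)[OF f] in \<open>auto simp: S_monoid_def\<close>)
  show "f \<otimes>\<^bsub>S_monoid G\<^esub> \<one>\<^bsub>S_monoid G\<^esub> = f"
  proof (rule extensionalityI)
    fix x assume x: "x \<in> carrier G"
    then show "(f \<otimes>\<^bsub>S_monoid G\<^esub> \<one>\<^bsub>S_monoid G\<^esub>) x = f x"
      using S_carrierD[OF f] by (simp add: S_monoid_def grange_mult grange_prod)
  qed (use S_carrierD(2)[OF f] in \<open>auto simp: S_monoid_def\<close>)
qed

theorem operator_monoid: "monoid (operator_monoid G)"
proof (rule monoidI)
  have add: "C_add G g h \<in> C_space G" if "g \<in> C_space G" "h \<in> C_space G" for g h
  proof -
    have "continuous_map (gtop G) euclidean (\<lambda>x. g x + h x)"
      using that by (auto simp: C_space_def intro: continuous_map_add)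
    from continuous_map_eq[OF this, of "C_add G g h"] show ?thesis
      by (auto simp: C_space_def C_add_def topspace_eq)
  qed
  have scale: "C_scale G c g \<in> C_space G" if "g \<in> C_space G" for c g
  proof -
    have "continuous_map (gtop G) euclidean ((\<lambda>z. c * z) \<circ> g)"
      using that by (intro continuous_map_compose[where X' = euclidean])
        (auto simp: C_space_def intro!: continuous_intros)
    from continuous_map_eq[OF this, of "C_scale G c g"] show ?thesis
      by (auto simp: C_space_def C_scale_def topspace_eq)
  qed
  show "\<one>\<^bsub>operator_monoid G\<^esub> \<in> carrier (operator_monoid G)"
    using add scale by (auto simp: operator_monoid_def linear_operators_def)
  fix L M
  assume "L \<in> carrier (operator_monoid G)" and "M \<in> carrier (operator_monoid G)"
  then show "L \<otimes>\<^bsub>operator_monoid G\<^esub> M \<in> carrier (operator_monoid G)"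
    using add scale by (auto simp: operator_monoid_def linear_operators_def compose_def PiE_iff)
qed (auto simp: operator_monoid_def linear_operators_def compose_def fun_eq_iff PiE_iff
    extensional_def)

end

end

theory Submission
  imports Defs
begin

text \<open>A map \<open>f \<in> S\<^sub>G\<close> is determined by the continuous self-map \<open>\<tau>\<^sub>f(x) = f(x)x\<close> of \<open>G\<close>: right
  multiplication by \<open>x\<inverse>\<close> recovers \<open>f(x)\<close>. The product of \<open>S\<^sub>G\<close> is the one that turns these
  self-maps into composition, in reversed order, \<open>\<tau>\<^bsub>f * g\<^esub> = \<tau>\<^sub>g \<circ> \<tau>\<^sub>f\<close>, and \<open>\<tau>\<^sub>r\<close> is the identity.
  Pulling functions back along \<open>\<tau>\<^sub>f\<close>, that is \<open>\<phi>(f, g) = g \<circ> \<tau>\<^sub>f\<close>, reverses the order once more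
  and so gives a left action on \<open>C(G)\<close> by linear operators.

  Two facts are topological. The action is faithful because a locally compact Hausdorff space
  has enough continuous functions to tell \<open>\<tau>\<^bsub>f\<^sub>1\<^esub>(x)\<close> from \<open>\<tau>\<^bsub>f\<^sub>2\<^esub>(x)\<close>
  (\<open>C_space_separates_points\<close>). For \<open>f \<in> T\<^sub>G\<close> the image of \<open>\<tau>\<^sub>f\<close> is dense, and a continuous function
  is determined by its values on a dense set (\<open>inj_on_pullback\<close>). The embedding of the group of
  units is formal: an injective monoid homomorphism restricts to the units.\<close>

definition pullback :: "('a, 'b) top_groupoid_scheme \<Rightarrow> ('a \<Rightarrow> 'a) \<Rightarrow> ('a \<Rightarrow> complex) \<Rightarrow> 'a \<Rightarrow> complex"
  where "pullback G f g = (\<lambda>x\<in>carrier G. g (f x \<cdot>\<^bsub>G\<^esub> x))"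

lemma mon_units_of:
  assumes "h \<in> mon M N" and "h \<one>\<^bsub>M\<^esub> = \<one>\<^bsub>N\<^esub>"
  shows "h \<in> mon (units_of M) (units_of N)"
proof -
  have hom: "h \<in> hom M N" and inj: "inj_on h (carrier M)"
    using assms by (auto simp: mon_def)
  have "h x \<in> Units N" if x: "x \<in> Units M" for x
  proof -
    obtain y where "x \<in> carrier M" "y \<in> carrier M" "y \<otimes>\<^bsub>M\<^esub> x = \<one>\<^bsub>M\<^esub>" "x \<otimes>\<^bsub>M\<^esub> y = \<one>\<^bsub>M\<^esub>"
      using x by (auto simp: Units_def)
    then have "h x \<in> carrier N" "h y \<in> carrier N"
      "h y \<otimes>\<^bsub>N\<^esub> h x = \<one>\<^bsub>N\<^esub>" "h x \<otimes>\<^bsub>N\<^esub> h y = \<one>\<^bsub>N\<^esub>"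
      using hom assms(2) by (auto simp: hom_in_carrier simp flip: hom_mult)
    then show ?thesis by (auto simp: Units_def)
  qed
  moreover have "Units M \<subseteq> carrier M" by (auto simp: Units_def)
  ultimately show ?thesis
    using hom inj
    by (auto simp: mon_def hom_def units_of_carrier units_of_mult subset_iff intro: inj_on_subset)
qed

lemma (in groupoid) right_cancel:
  assumes "(a, x) \<in> comps G" "(b, x) \<in> comps G" "a \<cdot> x = b \<cdot> x"
  shows "a = b"
  using assms inv_right by metis

context top_groupoid
begin

lemma C_spaceD:
  assumes "g \<in> C_space G"
  shows "continuous_map (gtop G) euclidean g" "g \<in> extensional (carrier G)"
  using assms by (auto simp: C_space_def)

lemma restrict_in_C_space:
  assumes "continuous_map (gtop G) euclidean g"
  shows "restrict g (carrier G) \<in> C_space G"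
  using continuous_map_eq[OF assms, of "restrict g (carrier G)"]
  by (auto simp: C_space_def topspace_eq)

lemma pullback_in_C_space:
  assumes f: "f \<in> carrier (S_monoid G)" and g: "g \<in> C_space G"
  shows "pullback G f g \<in> C_space G"
proof -
  have "continuous_map (gtop G) (gtop G) (\<lambda>x. f x \<cdot> x)"
    using f by (intro continuous_gprod) (auto simp: topspace_eq S_carrierD)
  from continuous_map_compose[OF this C_spaceD(1)[OF g]]
  show ?thesis
    unfolding pullback_def comp_def by (rule restrict_in_C_space)
qed

lemma pullback_in_linear_operators:
  assumes f: "f \<in> carrier (S_monoid G)"
  shows "restrict (pullback G f) (C_space G) \<in> linear_operators G"
proof -
  have "C_add G g h \<in> C_space G" if "g \<in> C_space G" "h \<in> C_space G" for g h
    unfolding C_add_def using that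
    by (intro restrict_in_C_space continuous_map_add C_spaceD)
  moreover have "C_scale G c g \<in> C_space G" if "g \<in> C_space G" for c g
  proof -
    have "continuous_map (gtop G) euclidean ((\<lambda>z. c * z) \<circ> g)"
      using C_spaceD(1)[OF that]
      by (rule continuous_map_compose) (auto intro!: continuous_intros)
    then show ?thesis
      unfolding C_scale_def comp_def by (rule restrict_in_C_space)
  qed
  ultimately show ?thesis
    using pullback_in_C_space[OF f] S_carrierD(6)[OF f]
    by (auto simp: linear_operators_def C_add_def C_scale_def pullback_def fun_eq_iff)
qed

text \<open>Associativity turns \<open>(f\<^sub>2(f\<^sub>1(x)x) f\<^sub>1(x)) x\<close> into \<open>f\<^sub>2(y)y\<close> with \<open>y = f\<^sub>1(x)x\<close>; this is
  what the product on \<open>S\<^sub>G\<close> is made for.\<close>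

lemma pullback_mult:
  assumes f1: "f1 \<in> carrier (S_monoid G)" and f2: "f2 \<in> carrier (S_monoid G)"
  shows "pullback G (f1 \<otimes>\<^bsub>S_monoid G\<^esub> f2) g = pullback G f1 (pullback G f2 g)"
proof -
  have "(f2 (f1 x \<cdot> x) \<cdot> f1 x) \<cdot> x = f2 (f1 x \<cdot> x) \<cdot> (f1 x \<cdot> x)" if "x \<in> carrier G" for x
    using assoc[OF S_comp_comps[OF f1 f2 that] S_carrierD(5)[OF f1 that]] .
  then show ?thesis
    using S_carrierD(6)[OF f1] by (auto simp: pullback_def S_monoid_def fun_eq_iff)
qed

lemma pullback_one:
  assumes "g \<in> C_space G"
  shows "pullback G \<one>\<^bsub>S_monoid G\<^esub> g = g"
proof (rule extensionalityI)
  show "pullback G \<one>\<^bsub>S_monoid G\<^esub> g x = g x" if "x \<in> carrier G" for x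
    using that by (simp add: pullback_def S_monoid_def grange_prod)
qed (use C_spaceD(2)[OF assms] in \<open>auto simp: pullback_def\<close>)

text \<open>The image of \<open>\<tau>\<^sub>f\<close> is dense and \<open>\<complex>\<close> is Hausdorff, so two continuous functions that agree
  along \<open>\<tau>\<^sub>f\<close> agree everywhere.\<close>

lemma inj_on_pullback:
  assumes f: "f \<in> T_set G"
  shows "inj_on (pullback G f) (C_space G)"
proof (rule inj_onI)
  fix g h
  assume g: "g \<in> C_space G" and h: "h \<in> C_space G" and eq: "pullback G f g = pullback G f h"
  have agree: "g y = h y" if "y \<in> {f x \<cdot> x | x. x \<in> carrier G}" for y
  proof -
    from that obtain x where "x \<in> carrier G" "y = f x \<cdot> x" by blast
    then show ?thesis using fun_cong[OF eq, of x] by (simp add: pullback_def)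
  qed
  show "g = h"
  proof (rule extensionalityI)
    fix y assume "y \<in> carrier G"
    then have "y \<in> gtop G closure_of {f x \<cdot> x | x. x \<in> carrier G}"
      using f by (simp add: T_set_def topspace_eq)
    from forall_in_closure_of_eq[OF this Hausdorff_space_euclidean C_spaceD(1)[OF g] C_spaceD(1)[OF h]]
    show "g y = h y" using agree by blast
  qed (use g h in \<open>auto simp: C_spaceD\<close>)
qed

end

context lch_groupoid
begin

text \<open>Locally compact Hausdorff spaces are completely regular, so a continuous real function
  separates \<open>a\<close> from the closed set \<open>{b}\<close>.\<close>

lemma C_space_separates_points:
  assumes "a \<in> carrier G" "b \<in> carrier G" "a \<noteq> b"
  shows "\<exists>g\<in>C_space G. g a \<noteq> g b"
proof -
  have "completely_regular_space (gtop G)"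
    using locally_compact Hausdorff locally_compact_regular_imp_completely_regular_space by blast
  moreover have "closedin (gtop G) {b}"
    using Hausdorff assms by (simp add: closedin_Hausdorff_singleton topspace_eq)
  moreover have "a \<in> topspace (gtop G) - {b}"
    using assms by (simp add: topspace_eq)
  ultimately obtain u :: "'a \<Rightarrow> real"
    where u: "continuous_map (gtop G) euclideanreal u" "u a = 0" "u ` {b} \<subseteq> {1}"
    unfolding completely_regular_space_alt by blast
  have "continuous_map (gtop G) euclidean (complex_of_real \<circ> u)"
    using u(1) by (rule continuous_map_compose) (auto intro!: continuous_intros)
  then have "restrict (complex_of_real \<circ> u) (carrier G) \<in> C_space G"
    by (rule restrict_in_C_space)
  then show ?thesis
    by (rule bexI[rotated]) (use u assms in simp)
qed

lemma pullback_faithful: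
  assumes f1: "f1 \<in> carrier (S_monoid G)" and f2: "f2 \<in> carrier (S_monoid G)"
    and eq: "\<And>g. g \<in> C_space G \<Longrightarrow> pullback G f1 g = pullback G f2 g"
  shows "f1 = f2"
proof (rule extensionalityI)
  fix x assume x: "x \<in> carrier G"
  have "g (f1 x \<cdot> x) = g (f2 x \<cdot> x)" if "g \<in> C_space G" for g
    using fun_cong[OF eq[OF that], of x] x by (simp add: pullback_def)
  then have "f1 x \<cdot> x = f2 x \<cdot> x"
    using C_space_separates_points S_carrierD(6)[OF f1 x] S_carrierD(6)[OF f2 x] by blast
  then show "f1 x = f2 x"
    using right_cancel S_carrierD(5)[OF f1 x] S_carrierD(5)[OF f2 x] by blast
qed (use S_carrierD(2) f1 f2 in auto)

lemma pullback_mon: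
  "(\<lambda>f. restrict (pullback G f) (C_space G)) \<in> mon (S_monoid G) (operator_monoid G)"
proof -
  have "inj_on (\<lambda>f. restrict (pullback G f) (C_space G)) (carrier (S_monoid G))"
  proof (rule inj_onI)
    fix f1 f2
    assume f1: "f1 \<in> carrier (S_monoid G)" and f2: "f2 \<in> carrier (S_monoid G)"
      and eq: "restrict (pullback G f1) (C_space G) = restrict (pullback G f2) (C_space G)"
    show "f1 = f2"
      by (rule pullback_faithful[OF f1 f2]) (metis eq restrict_apply')
  qed
  moreover have "(\<lambda>f. restrict (pullback G f) (C_space G)) \<in> hom (S_monoid G) (operator_monoid G)"
    using pullback_in_linear_operators pullback_mult pullback_in_C_space
    by (auto intro!: homI simp: operator_monoid_def compose_def)
  ultimately show ?thesis by (simp add: mon_def)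
qed

end

theorem proposition4p1:
  fixes G :: "('a, 'b) top_groupoid_scheme"
  assumes "lch_groupoid G"
  defines "S \<equiv> S_monoid G" and "C \<equiv> C_space G"
  shows "\<exists>\<phi> \<in> carrier S \<times> C \<rightarrow> C.
    \<comment> \<open>(1)\<close> (\<forall>f1\<in>carrier S. \<forall>f2\<in>carrier S. \<forall>g\<in>C. \<phi> (f1 \<otimes>\<^bsub>S\<^esub> f2, g) = \<phi> (f1, \<phi> (f2, g))) \<and>
    \<comment> \<open>(2)\<close> (\<forall>g\<in>C. \<phi> (\<lambda>x\<in>carrier G. grange G x, g) = g) \<and>
    \<comment> \<open>(3)\<close> ((\<forall>f\<in>carrier S. (\<lambda>g\<in>C. \<phi> (f, g)) \<in> linear_operators G) \<and>
           (\<lambda>f. \<lambda>g\<in>C. \<phi> (f, g)) \<in> mon S (operator_monoid G) \<and>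
           (\<lambda>g\<in>C. \<phi> (\<one>\<^bsub>S\<^esub>, g)) = \<one>\<^bsub>operator_monoid G\<^esub>) \<and>
    \<comment> \<open>(4)\<close> (\<forall>f\<in>T_set G. inj_on (\<lambda>g\<in>C. \<phi> (f, g)) C) \<and>
    \<comment> \<open>(5)\<close> (\<exists>h. h \<in> mon (units_of S) (units_of (operator_monoid G)))"
proof -
  interpret lch_groupoid G by fact
  let ?\<phi> = "\<lambda>(f, g). pullback G f g"
  have r: "(\<lambda>x\<in>carrier G. grange G x) = \<one>\<^bsub>S\<^esub>"
    by (simp add: S_def S_monoid_def)
  have mon: "(\<lambda>f. restrict (pullback G f) C) \<in> mon S (operator_monoid G)"
    unfolding S_def C_def by (rule pullback_mon)
  have one: "(\<lambda>g\<in>C. pullback G \<one>\<^bsub>S\<^esub> g) = \<one>\<^bsub>operator_monoid G\<^esub>"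
    using pullback_one by (auto simp: S_def C_def operator_monoid_def)
  have closed: "?\<phi> \<in> carrier S \<times> C \<rightarrow> C"
    using pullback_in_C_space by (auto simp: S_def C_def)
  have inj: "inj_on (pullback G f) C" if "f \<in> T_set G" for f
    using inj_on_pullback[OF that] by (simp add: C_def)
  have lin: "restrict (pullback G f) C \<in> linear_operators G" if "f \<in> carrier S" for f
    using that pullback_in_linear_operators by (simp add: S_def C_def)
  have units: "\<exists>h. h \<in> mon (units_of S) (units_of (operator_monoid G))"
    by (rule exI, rule mon_units_of[OF mon], rule one)
  have act: "pullback G (f1 \<otimes>\<^bsub>S\<^esub> f2) g = pullback G f1 (pullback G f2 g)"
    if "f1 \<in> carrier S" "f2 \<in> carrier S" for f1 f2 g
    using that pullback_mult by (simp add: S_def)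
  have unit: "pullback G \<one>\<^bsub>S\<^esub> g = g" if "g \<in> C" for g
    using that pullback_one by (simp add: S_def C_def)
  show ?thesis
    by (rule bexI[OF _ closed]) (simp add: r act unit lin mon one[simplified unit] inj units)
qed

end
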